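(* Let $n$ be a natural number. Then the group $\mathbb{Z}_n\oplus \mathbb{Z}_n$ is capable but it is not $\mathfrak{S}_2$-capable.
   Context: $\mathbb{Z}_n$ is the cyclic group of order $n$. A group $G$ is capable if $G\cong E/Z(E)$ for some group $E$, where $Z(E)$ is the center of $E$. $\mathfrak{S}_2$ is the variety of metabelian groups (solvable of length at most 2), defined by the word $[[x_1,x_2],[y_1,y_2]]$. For a set of words $V$ defining a variety $\mathfrak V$ and a group $E$, the marginal subgroup $V^*(E)$ is the set of all $a\in E$ such that $v(g_1,\dots,g_{i-1},g_ia,g_{i+1},\dots,g_n)=v(g_1,\dots,g_n)$ for all $v\in V$, all $g_1,\dots,g_n\in E$ and all $1\le i\le n$. A group $G$ is $\mathfrak V$-capable if there is a group $E$ with $G\cong E/V^*(E)$.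
   Formalization: The claim that the group is not S_2-capable is stated only for n ≠ 1, since for n = 1 the group is trivial and equals E/V*(E) with E trivial; capability is stated for every n ≥ 1. *)

theory Defs
  imports "HOL-Algebra.Algebra"
begin

definition group_center :: "('a, 'b) monoid_scheme \<Rightarrow> 'a set" where
  "group_center E = {a \<in> carrier E. \<forall>x \<in> carrier E. a \<otimes>\<^bsub>E\<^esub> x = x \<otimes>\<^bsub>E\<^esub> a}"

(* Group words as terms. Terms equal in the free group have equal values in every group. *)
datatype group_word =
    Var nat
  | Unit
  | Mult group_word group_word
  | Inv group_word

fun word_value :: "('a, 'b) monoid_scheme \<Rightarrow> (nat \<Rightarrow> 'a) \<Rightarrow> group_word \<Rightarrow> 'a" where
  "word_value E g (Var i) = g i"
| "word_value E g Unit = \<one>\<^bsub>E\<^esub>"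
| "word_value E g (Mult v w) = word_value E g v \<otimes>\<^bsub>E\<^esub> word_value E g w"
| "word_value E g (Inv w) = inv\<^bsub>E\<^esub> (word_value E g w)"

definition word_commutator :: "group_word \<Rightarrow> group_word \<Rightarrow> group_word" where
  "word_commutator v w = Mult (Mult (Inv v) (Inv w)) (Mult v w)"

(* The word [[x1, x2], [y1, y2]] *)
definition metabelian_word :: group_word where
  "metabelian_word =
     word_commutator (word_commutator (Var 0) (Var 1)) (word_commutator (Var 2) (Var 3))"

(* The tuple (g_1, ..., g_n) is the part of the assignment g seen by the variables of v.
   The condition is vacuous at an index i that does not occur in v. *)
definition marginal_subgroup :: "group_word set \<Rightarrow> ('a, 'b) monoid_scheme \<Rightarrow> 'a set" where
  "marginal_subgroup V E =
     {a \<in> carrier E. \<forall>v \<in> V. \<forall>g \<in> UNIV \<rightarrow> carrier E. \<forall>i.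
        word_value E (g(i := g i \<otimes>\<^bsub>E\<^esub> a)) v = word_value E g v}"

(* HOL cannot quantify over the type of the elements of E inside a formula, so this type is
   the parameter 'e. An element type can be fixed to assert capability. To deny
   capability outright, 'e has to be left arbitrary.
   A countable G which is E/Z(E) for some E is also E0/Z(E0) for a countable subgroup E0,
   so for countable G the type nat realises the unrestricted notion. *)
definition capable :: "'e itself \<Rightarrow> ('a, 'b) monoid_scheme \<Rightarrow> bool" where
  "capable _ G \<longleftrightarrow> (\<exists>E :: 'e monoid. group E \<and> G \<cong> E Mod group_center E)"

definition variety_capable ::
    "'e itself \<Rightarrow> group_word set \<Rightarrow> ('a, 'b) monoid_scheme \<Rightarrow> bool" where
  "variety_capable _ V G \<longleftrightarrow> (\<exists>E :: 'e monoid. group E \<and> G \<cong> E Mod marginal_subgroup V E)"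

end

theory Submission
  imports Defs
begin

text \<open>
  The Heisenberg group modulo \<open>n\<close> has centre \<open>\<int>\<^sub>n\<close> and central quotient \<open>\<int>\<^sub>n \<oplus> \<int>\<^sub>n\<close>.

  Now let \<open>M\<close> be the marginal subgroup of \<open>E\<close>, with \<open>E / M\<close> abelian and generated by the images of
  \<open>x\<close> and \<open>y\<close>. By marginality \<open>[M, E]\<close> lies in the centraliser \<open>C\<close> of the set of commutators, and
  commutators lie in \<open>M\<close>, so \<open>[a, b]\<close> is bimultiplicative modulo \<open>C\<close>. Therefore every subgroup
  containing \<open>C\<close> and \<open>[x, y]\<close> contains all commutators. The centraliser of \<open>[x, y]\<close> is such a
  subgroup, which gives \<open>[x, y] \<in> C\<close>; hence \<open>C\<close> is one too. So \<open>E\<close> is metabelian, \<open>M = E\<close>, and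
  \<open>E / M\<close> is trivial.
\<close>

section \<open>Capability via the Heisenberg group\<close>

text \<open>\<open>capable TYPE(nat)\<close> asks for a group on natural numbers. A countable
  \<open>E\<close> is carried there along \<open>to_nat\<close>, the centre moves with it, and the
  first isomorphism theorem gives the central quotient.\<close>

lemma capable_nat_if_kernel_center:
  fixes E :: "('e::countable, 'm) monoid_scheme" and G (structure)
  assumes "group_hom E G f" and surj: "f ` carrier E = carrier G"
    and ker: "kernel E G f = group_center E"
  shows "capable TYPE(nat) G"
proof -
  interpret f: group_hom E G f
    by fact
  let ?N = "image_group to_nat E" and ?f = "\<lambda>k. f (from_nat k)"
  have inj: "inj_on to_nat (carrier E)"
    by (simp add: inj_on_def)
  have mult: "to_nat x \<otimes>\<^bsub>?N\<^esub> to_nat y = to_nat (x \<otimes>\<^bsub>E\<^esub> y)"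
    if "x \<in> carrier E" "y \<in> carrier E" for x y
    unfolding image_group_def by (simp add: inv_into_f_f[OF inj] that)
  have "weak_group_morphism to_nat {\<one>\<^bsub>E\<^esub>} E"
  proof (rule weak_group_morphismsI[OF f.G.one_is_normal])
    fix a b
    assume ab: "a \<in> carrier E" "b \<in> carrier E"
    have "a \<otimes>\<^bsub>E\<^esub> inv\<^bsub>E\<^esub> b = \<one>\<^bsub>E\<^esub> \<longleftrightarrow> a = b"
      by (subst f.G.inv_solve_right') (simp_all add: ab)
    then show "to_nat a = to_nat b \<longleftrightarrow> a \<otimes>\<^bsub>E\<^esub> inv\<^bsub>E\<^esub> b \<in> {\<one>\<^bsub>E\<^esub>}"
      by simp
  qed
  then have "group ?N"
    by (rule f.G.image_group_is_group)
  then have N: "group_hom ?N G ?f"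
    by (auto simp: group_hom_def group_hom_axioms_def hom_def image_group_carrier mult)
  have "kernel ?N G ?f = to_nat ` kernel E G f"
    by (auto simp: kernel_def image_group_carrier)
  also have "\<dots> = group_center ?N"
    by (auto simp: ker group_center_def image_group_carrier mult)
  finally have ker_N: "kernel ?N G ?f = group_center ?N" .
  have "?f ` carrier ?N = carrier G"
    using surj by (simp add: image_group_carrier image_image)
  from group_hom.FactGroup_iso[OF N this] have "?N Mod group_center ?N \<cong> G"
    by (simp only: ker_N)
  moreover have "group (?N Mod group_center ?N)"
    using normal.factorgroup_is_group[OF group_hom.normal_kernel[OF N]] by (simp only: ker_N)
  ultimately have "G \<cong> ?N Mod group_center ?N"
    by (rule group.iso_sym[rotated])
  with \<open>group ?N\<close> show ?thesis
    unfolding capable_def by (intro exI conjI)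
qed

text \<open>The triple \<open>(a, b, c)\<close> stands for the unitriangular matrix with rows
  \<open>(1, a, c)\<close>, \<open>(0, 1, b)\<close>, \<open>(0, 0, 1)\<close>, with residues as
  entries.\<close>

definition heisenberg_mod :: "nat \<Rightarrow> (int \<times> int \<times> int) monoid" where
  "heisenberg_mod n =
     \<lparr>carrier = {0..<int n} \<times> {0..<int n} \<times> {0..<int n},
      monoid.mult = (\<lambda>(a, b, c) (a', b', c').
        ((a + a') mod int n, (b + b') mod int n, (c + c' + a * b') mod int n)),
      monoid.one = (0, 0, 0)\<rparr>"

lemma group_heisenberg_mod:
  assumes "n \<ge> 1"
  shows "group (heisenberg_mod n)"
proof (rule groupI)
  fix x y z :: "int \<times> int \<times> int"
  obtain a b c a' b' c' a'' b'' c'' where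
    eqs: "x = (a, b, c)" "y = (a', b', c')" "z = (a'', b'', c'')"
    by (metis prod_cases3)
  have "((c + c' + a * b') mod int n + c'' + (a + a') mod int n * b'') mod int n =
      (c + c' + a * b' + c'' + (a + a') * b'') mod int n"
    by (intro mod_add_cong mod_mult_cong) simp_all
  also have "\<dots> = (c + (c' + c'' + a' * b'') + a * (b' + b'')) mod int n"
    by (simp add: algebra_simps)
  also have "\<dots> = (c + (c' + c'' + a' * b'') mod int n + a * ((b' + b'') mod int n)) mod int n"
    by (intro mod_add_cong mod_mult_cong) simp_all
  finally show "x \<otimes>\<^bsub>heisenberg_mod n\<^esub> y \<otimes>\<^bsub>heisenberg_mod n\<^esub> z =
      x \<otimes>\<^bsub>heisenberg_mod n\<^esub> (y \<otimes>\<^bsub>heisenberg_mod n\<^esub> z)"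
    by (simp add: heisenberg_mod_def eqs mod_simps add.assoc)
next
  fix x
  assume "x \<in> carrier (heisenberg_mod n)"
  then obtain a b c where x: "x = (a, b, c)"
    by (cases x)
  \<comment> \<open>The inverse matrix has entries \<open>- a\<close>, \<open>- b\<close> and
    \<open>a * b - c\<close>.\<close>
  have "((- a) mod int n, (- b) mod int n, (a * b - c) mod int n) \<in> carrier (heisenberg_mod n)"
    using assms by (simp add: heisenberg_mod_def)
  moreover have "((- a) mod int n, (- b) mod int n, (a * b - c) mod int n) \<otimes>\<^bsub>heisenberg_mod n\<^esub> x =
      \<one>\<^bsub>heisenberg_mod n\<^esub>"
  proof -
    \<comment> \<open>Each remainder is expanded as the number minus a multiple of \<open>n\<close>,
      so that the corner entry becomes a visible multiple of \<open>n\<close>.\<close>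
    have "(a * b - c) mod int n + c + (- a) mod int n * b
        = (a * b - c) - int n * ((a * b - c) div int n) + c + (- a - int n * ((- a) div int n)) * b"
      by (simp add: minus_div_mult_eq_mod [symmetric] mult.commute)
    also have "\<dots> = int n * (- ((a * b - c) div int n) - ((- a) div int n) * b)"
      by (simp add: algebra_simps)
    finally show ?thesis
      by (simp add: heisenberg_mod_def x mod_simps)
  qed
  ultimately show "\<exists>y\<in>carrier (heisenberg_mod n). y \<otimes>\<^bsub>heisenberg_mod n\<^esub> x = \<one>\<^bsub>heisenberg_mod n\<^esub>"
    by blast
qed (use assms in \<open>auto simp: heisenberg_mod_def\<close>)

lemma group_center_heisenberg_mod:
  assumes "n \<ge> 1"
  shows "group_center (heisenberg_mod n) = {0} \<times> {0} \<times> {0..<int n}"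
proof
  show "group_center (heisenberg_mod n) \<subseteq> {0} \<times> {0} \<times> {0..<int n}"
  proof
    fix x
    assume x: "x \<in> group_center (heisenberg_mod n)"
    obtain a b c where x_eq: "x = (a, b, c)"
      by (cases x)
    have bounds: "a \<in> {0..<int n}" "b \<in> {0..<int n}" "c \<in> {0..<int n}"
      using x by (auto simp: group_center_def heisenberg_mod_def x_eq)
    have comm: "x \<otimes>\<^bsub>heisenberg_mod n\<^esub> y = y \<otimes>\<^bsub>heisenberg_mod n\<^esub> x" if "y \<in> carrier (heisenberg_mod n)" for y
      using x that by (simp add: group_center_def)
    \<comment> \<open>Commuting with these two elements forces \<open>n\<close> to divide
      \<open>b\<close> and \<open>a\<close>. Writing \<open>1 mod int n\<close> keeps them in the
      carrier also when \<open>n = 1\<close>.\<close>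
    have "(1 mod int n, 0, 0) \<in> carrier (heisenberg_mod n)" "(0, 1 mod int n, 0) \<in> carrier (heisenberg_mod n)"
      using assms by (auto simp: heisenberg_mod_def)
    from this[THEN comm] have "c mod int n = (c + 1 mod int n * b) mod int n"
        "(c + a * (1 mod int n)) mod int n = c mod int n"
      by (simp_all add: heisenberg_mod_def x_eq)
    moreover have "(c + 1 mod int n * b) mod int n = (c + 1 * b) mod int n"
        "(c + a * (1 mod int n)) mod int n = (c + a * 1) mod int n"
      by (intro mod_add_cong mod_mult_cong; simp)+
    ultimately have "int n dvd b" "int n dvd a"
      by (simp_all add: mod_eq_dvd_iff)
    then have "a = 0" "b = 0"
      using bounds by (auto dest: zdvd_imp_le)
    then show "x \<in> {0} \<times> {0} \<times> {0..<int n}"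
      using bounds by (simp add: x_eq)
  qed
  show "{0} \<times> {0} \<times> {0..<int n} \<subseteq> group_center (heisenberg_mod n)"
    using assms by (auto simp: group_center_def heisenberg_mod_def add.commute)
qed

lemma capable_nat_integer_mod_group_square:
  assumes "n \<ge> 1"
  shows "capable TYPE(nat) (integer_mod_group n \<times>\<times> integer_mod_group n)"
proof -
  let ?H = "heisenberg_mod n" and ?G = "integer_mod_group n \<times>\<times> integer_mod_group n"
    and ?f = "\<lambda>(a, b, c). (a, b) :: int \<times> int"
  \<comment> \<open>Forgetting the corner entry is a homomorphism, and its kernel is the centre
    computed above.\<close>
  have "group_hom ?H ?G ?f"
    using group_heisenberg_mod[OF assms] DirProd_group[of "integer_mod_group n" "integer_mod_group n"]
    unfolding group_hom_def group_hom_axioms_def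
    by (auto simp: hom_def heisenberg_mod_def carrier_integer_mod_group)
  moreover have "?f ` carrier ?H = carrier ?G"
    using assms by (force simp: heisenberg_mod_def carrier_integer_mod_group DirProd_def image_iff)
  moreover have "kernel ?H ?G ?f = group_center ?H"
    unfolding group_center_heisenberg_mod[OF assms]
    using assms by (auto simp: kernel_def heisenberg_mod_def)
  ultimately show ?thesis
    by (rule capable_nat_if_kernel_center)
qed

section \<open>Marginal subgroups\<close>

lemma (in group) word_value_closed:
  assumes "g \<in> UNIV \<rightarrow> carrier G"
  shows "word_value G g w \<in> carrier G"
  using assms by (induction w) auto

text \<open>Applied to conjugations, this moves a conjugation from the assignment to the value of
  the word, which yields normality of marginal subgroups.\<close>

lemma (in group_hom) hom_word_value:
  assumes "g \<in> UNIV \<rightarrow> carrier G"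
  shows "word_value H (h \<circ> g) w = h (word_value G g w)"
  using assms by (induction w) (auto simp: G.word_value_closed)

lemma (in group) mult_inv_mult_cancel:
  assumes "a \<in> carrier G" "b \<in> carrier G"
  shows "a \<otimes> (inv a \<otimes> b) = b" "inv a \<otimes> (a \<otimes> b) = b"
  using assms by (simp_all add: m_assoc [symmetric])

lemma (in group) conjugation_hom:
  assumes "a \<in> carrier G"
  shows "group_hom G G (\<lambda>x. a \<otimes> x \<otimes> inv a)"
proof -
  have "a \<otimes> (x \<otimes> y) \<otimes> inv a = a \<otimes> x \<otimes> inv a \<otimes> (a \<otimes> y \<otimes> inv a)"
    if "x \<in> carrier G" "y \<in> carrier G" for x y
    using assms that by (simp add: m_assoc mult_inv_mult_cancel)
  then show ?thesis
    using assms by (auto simp: group_hom_def group_hom_axioms_def hom_def)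
qed

text \<open>Shifting a variable by \<open>a \<otimes> b\<close> is shifting by \<open>a\<close> and
  then by \<open>b\<close>, and a shift by \<open>inv a\<close> is undone by a shift by
  \<open>a\<close>. Conjugation is an automorphism, so it preserves marginality.\<close>

lemma (in group) marginal_subgroup_normal: "marginal_subgroup V G \<lhd> G"
proof (rule normal_invI)
  show "subgroup (marginal_subgroup V G) G"
  proof
    fix a b
    assume a: "a \<in> marginal_subgroup V G" and b: "b \<in> marginal_subgroup V G"
    have "word_value G (g(i := g i \<otimes> (a \<otimes> b))) v = word_value G g v"
      if "v \<in> V" "g \<in> UNIV \<rightarrow> carrier G" for v g i
    proof -
      let ?g = "g(i := g i \<otimes> a)"
      have "?g \<in> UNIV \<rightarrow> carrier G"
        using a that by (auto simp: marginal_subgroup_def Pi_iff)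
      then have "word_value G (?g(i := ?g i \<otimes> b)) v = word_value G ?g v"
        using b that by (simp only: marginal_subgroup_def mem_Collect_eq)
      moreover have "word_value G ?g v = word_value G g v"
        using a that by (simp add: marginal_subgroup_def)
      moreover have "g i \<otimes> a \<otimes> b = g i \<otimes> (a \<otimes> b)"
        using a b that by (intro m_assoc) (auto simp: marginal_subgroup_def)
      ultimately show ?thesis
        by simp
    qed
    then show "a \<otimes> b \<in> marginal_subgroup V G"
      using a b by (simp add: marginal_subgroup_def)
  next
    fix a
    assume a: "a \<in> marginal_subgroup V G"
    have "word_value G (g(i := g i \<otimes> inv a)) v = word_value G g v"
      if "v \<in> V" "g \<in> UNIV \<rightarrow> carrier G" for v g i
    proof -
      let ?g = "g(i := g i \<otimes> inv a)"
      have "?g \<in> UNIV \<rightarrow> carrier G"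
        using a that by (auto simp: marginal_subgroup_def Pi_iff)
      then have "word_value G (?g(i := ?g i \<otimes> a)) v = word_value G ?g v"
        using a that by (simp only: marginal_subgroup_def mem_Collect_eq)
      moreover have "g i \<otimes> inv a \<otimes> a = g i"
        using a that by (auto simp: marginal_subgroup_def m_assoc Pi_iff)
      ultimately show ?thesis
        by simp
    qed
    then show "inv a \<in> marginal_subgroup V G"
      using a by (simp add: marginal_subgroup_def)
  qed (auto simp: marginal_subgroup_def Pi_iff)
next
  fix x a
  assume x: "x \<in> carrier G" and a: "a \<in> marginal_subgroup V G"
  interpret conj: group_hom G G "\<lambda>y. x \<otimes> y \<otimes> inv x"
    using x by (rule conjugation_hom)
  have "word_value G (g(i := g i \<otimes> (x \<otimes> a \<otimes> inv x))) v = word_value G g v"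
    if "v \<in> V" "g \<in> UNIV \<rightarrow> carrier G" for v g i
  proof -
    \<comment> \<open>The assignment is conjugated by \<open>inv x\<close>; conjugating the shift of
      \<open>?h i\<close> by \<open>a\<close> back with \<open>x\<close> then gives the shift of
      \<open>g i\<close> by \<open>x \<otimes> a \<otimes> inv x\<close>.\<close>
    let ?h = "\<lambda>j. inv x \<otimes> g j \<otimes> x"
    have h: "?h \<in> UNIV \<rightarrow> carrier G" "?h(i := ?h i \<otimes> a) \<in> UNIV \<rightarrow> carrier G"
      using x a that by (auto simp: marginal_subgroup_def Pi_iff)
    have cancel: "x \<otimes> (inv x \<otimes> g j \<otimes> x) \<otimes> inv x = g j" for j
      using x that by (auto simp: m_assoc Pi_iff mult_inv_mult_cancel)
    then have "x \<otimes> (inv x \<otimes> g i \<otimes> x \<otimes> a) \<otimes> inv x = g i \<otimes> (x \<otimes> a \<otimes> inv x)"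
      using x a that conj.hom_mult[of "?h i" a] by (auto simp: marginal_subgroup_def Pi_iff)
    with cancel have
      "g = (\<lambda>y. x \<otimes> y \<otimes> inv x) \<circ> ?h"
      "g(i := g i \<otimes> (x \<otimes> a \<otimes> inv x)) = (\<lambda>y. x \<otimes> y \<otimes> inv x) \<circ> ?h(i := ?h i \<otimes> a)"
      by (auto simp: fun_eq_iff)
    moreover have "word_value G (?h(i := ?h i \<otimes> a)) v = word_value G ?h v"
    proof -
      have "word_value G (k(i := k i \<otimes> a)) v = word_value G k v" if "k \<in> UNIV \<rightarrow> carrier G" for k
        using a \<open>v \<in> V\<close> that by (simp add: marginal_subgroup_def)
      from this[OF h(1)] show ?thesis .
    qed
    ultimately show ?thesis
      using conj.hom_word_value[OF h(1)] conj.hom_word_value[OF h(2)] by metis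
  qed
  then show "x \<otimes> a \<otimes> inv x \<in> marginal_subgroup V G"
    using x a by (simp add: marginal_subgroup_def)
qed

section \<open>Groups with a two-generated quotient\<close>

text \<open>The convention agrees with that of \<open>word_commutator\<close>.\<close>

definition commutator :: "('a, 'b) monoid_scheme \<Rightarrow> 'a \<Rightarrow> 'a \<Rightarrow> 'a" where
  "commutator G a b = (inv\<^bsub>G\<^esub> a \<otimes>\<^bsub>G\<^esub> inv\<^bsub>G\<^esub> b) \<otimes>\<^bsub>G\<^esub> (a \<otimes>\<^bsub>G\<^esub> b)"

definition centralizer :: "('a, 'b) monoid_scheme \<Rightarrow> 'a set \<Rightarrow> 'a set" where
  "centralizer G S = {a \<in> carrier G. \<forall>s \<in> S. a \<otimes>\<^bsub>G\<^esub> s = s \<otimes>\<^bsub>G\<^esub> a}"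

context group
begin

lemma centralizer_subgroup:
  assumes "S \<subseteq> carrier G"
  shows "subgroup (centralizer G S) G"
proof
  fix a b
  assume ab: "a \<in> centralizer G S" "b \<in> centralizer G S"
  have "a \<otimes> b \<otimes> s = s \<otimes> (a \<otimes> b)" if "s \<in> S" for s
  proof -
    have [simp]: "a \<in> carrier G" "b \<in> carrier G" "s \<in> carrier G"
      using ab assms that by (auto simp: centralizer_def)
    have "a \<otimes> b \<otimes> s = a \<otimes> (s \<otimes> b)"
      using ab that by (simp add: centralizer_def m_assoc)
    also have "\<dots> = a \<otimes> s \<otimes> b"
      by (simp add: m_assoc)
    also have "\<dots> = s \<otimes> (a \<otimes> b)"
      using ab that by (simp add: centralizer_def m_assoc)
    finally show ?thesis .
  qed
  then show "a \<otimes> b \<in> centralizer G S"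
    using ab by (simp add: centralizer_def)
next
  fix a
  assume a: "a \<in> centralizer G S"
  have "inv a \<otimes> s = s \<otimes> inv a" if "s \<in> S" for s
  proof -
    have [simp]: "a \<in> carrier G" "s \<in> carrier G"
      using a assms that by (auto simp: centralizer_def)
    have "inv a \<otimes> s = inv a \<otimes> (s \<otimes> a) \<otimes> inv a"
      by (simp add: m_assoc)
    also have "s \<otimes> a = a \<otimes> s"
      using a that by (simp add: centralizer_def)
    also have "inv a \<otimes> (a \<otimes> s) \<otimes> inv a = s \<otimes> inv a"
      by (simp add: mult_inv_mult_cancel)
    finally show ?thesis .
  qed
  then show "inv a \<in> centralizer G S"
    using a by (simp add: centralizer_def)
qed (use assms in \<open>auto simp: centralizer_def\<close>)

section \<open>Commutator calculus\<close>

lemma commutator_closed [simp]: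
  "a \<in> carrier G \<Longrightarrow> b \<in> carrier G \<Longrightarrow> commutator G a b \<in> carrier G"
  by (simp add: commutator_def)

lemma commutator_self [simp]: "a \<in> carrier G \<Longrightarrow> commutator G a a = \<one>"
  by (simp add: commutator_def m_assoc mult_inv_mult_cancel)

lemma inv_commutator:
  "a \<in> carrier G \<Longrightarrow> b \<in> carrier G \<Longrightarrow> inv (commutator G a b) = commutator G b a"
  by (simp add: commutator_def m_assoc inv_mult_group)

lemma commutator_one_left [simp]: "a \<in> carrier G \<Longrightarrow> commutator G \<one> a = \<one>"
  by (simp add: commutator_def)

text \<open>The first two factors form the conjugate of \<open>commutator G a g\<close> by
  \<open>b\<close>. In this form the deviation from multiplicativity is a triple commutator.\<close>

lemma commutator_mult_left:
  assumes "a \<in> carrier G" "b \<in> carrier G" "g \<in> carrier G"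
  shows "commutator G (a \<otimes> b) g =
    commutator G a g \<otimes> commutator G (commutator G a g) b \<otimes> commutator G b g"
  using assms by (simp add: commutator_def m_assoc inv_mult_group mult_inv_mult_cancel)

lemma commutator_eq_one_iff:
  assumes "a \<in> carrier G" "b \<in> carrier G"
  shows "commutator G a b = \<one> \<longleftrightarrow> a \<otimes> b = b \<otimes> a"
proof -
  have "commutator G a b = inv (b \<otimes> a) \<otimes> (a \<otimes> b)"
    using assms by (simp add: commutator_def inv_mult_group)
  then show ?thesis
    using assms by (metis inv_solve_left m_closed one_closed r_one)
qed

text \<open>With triple commutators in \<open>A\<close>, the map from \<open>a\<close> to
  \<open>commutator G a g\<close> is multiplicative up to a factor in \<open>A\<close>, by
  \<open>commutator_mult_left\<close>.\<close>

lemma subgroup_vimage_commutator: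
  assumes A: "subgroup A G" and g: "g \<in> carrier G"
    and triple: "\<And>a b c. a \<in> carrier G \<Longrightarrow> b \<in> carrier G \<Longrightarrow> c \<in> carrier G \<Longrightarrow>
      commutator G (commutator G a b) c \<in> A"
  shows "subgroup {a \<in> carrier G. commutator G a g \<in> A} G"
proof
  fix a b
  assume "a \<in> {a \<in> carrier G. commutator G a g \<in> A}" "b \<in> {a \<in> carrier G. commutator G a g \<in> A}"
  then show "a \<otimes> b \<in> {a \<in> carrier G. commutator G a g \<in> A}"
    using A g triple by (simp add: commutator_mult_left subgroup.m_closed)
next
  fix a
  assume a: "a \<in> {a \<in> carrier G. commutator G a g \<in> A}"
  \<comment> \<open>Expanding the commutator of \<open>a \<otimes> inv a\<close> with
    \<open>g\<close>, which is trivial, shows that \<open>?c\<close> is the inverse of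
    \<open>commutator G (inv a) g\<close>.\<close>
  let ?c = "commutator G a g \<otimes> commutator G (commutator G a g) (inv a)"
  have "?c \<in> A"
    using A a g triple by (simp add: subgroup.m_closed)
  moreover have "?c \<otimes> commutator G (inv a) g = \<one>"
    using a g commutator_mult_left[of a "inv a" g] by simp
  then have "inv (commutator G (inv a) g) = ?c"
    using a g by (intro inv_equality) auto
  then have "commutator G (inv a) g = inv ?c"
    using a g by (metis (no_types, lifting) commutator_closed inv_closed inv_inv mem_Collect_eq)
  ultimately show "inv a \<in> {a \<in> carrier G. commutator G a g \<in> A}"
    using A a by (simp add: subgroup.m_inv_closed)
qed (use A g in \<open>auto simp: subgroup.one_closed\<close>)

text \<open>Commutators lie in \<open>M\<close>, so triple commutators lie in \<open>A\<close> and
  \<open>subgroup_vimage_commutator\<close> applies. Membership in \<open>A\<close> then needs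
  checking only on generators, one argument at a time.\<close>

lemma commutator_in_subgroup_if_two_generated:
  assumes A: "subgroup A G"
    and MA: "\<And>m g. m \<in> M \<Longrightarrow> g \<in> carrier G \<Longrightarrow> commutator G m g \<in> A"
    and comm: "\<And>a b. a \<in> carrier G \<Longrightarrow> b \<in> carrier G \<Longrightarrow> commutator G a b \<in> M"
    and xy: "x \<in> carrier G" "y \<in> carrier G" and M: "M \<subseteq> carrier G"
    and gen: "generate G (insert x (insert y M)) = carrier G"
    and xyA: "commutator G x y \<in> A"
    and ab: "a \<in> carrier G" "b \<in> carrier G"
  shows "commutator G a b \<in> A"
proof -
  have swap: "commutator G v u \<in> A" if "commutator G u v \<in> A" "u \<in> carrier G" "v \<in> carrier G" for u v
    using subgroup.m_inv_closed[OF A that(1)] that by (simp add: inv_commutator)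
  \<comment> \<open>For fixed \<open>g\<close> the suitable \<open>u\<close> form a subgroup, which
    contains \<open>M\<close> by \<open>MA\<close> and \<open>x\<close>, \<open>y\<close> by
    assumption.\<close>
  have all_if: "\<forall>u\<in>carrier G. commutator G u g \<in> A"
    if g: "g \<in> carrier G" "commutator G x g \<in> A" "commutator G y g \<in> A" for g
  proof -
    have "generate G (insert x (insert y M)) \<subseteq> {u \<in> carrier G. commutator G u g \<in> A}"
      by (intro generate_subgroup_incl subgroup_vimage_commutator)
        (use A MA comm M xy g in auto)
    then show ?thesis
      by (auto simp: gen)
  qed
  \<comment> \<open>First \<open>g\<close> is a generator, where self-commutators are trivial. Then
    \<open>swap\<close> supplies the hypotheses of \<open>all_if\<close> for
    \<open>g = b\<close>.\<close>
  have "\<forall>u\<in>carrier G. commutator G u x \<in> A" "\<forall>u\<in>carrier G. commutator G u y \<in> A"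
    by (rule all_if; use A xy xyA swap in \<open>simp add: subgroup.one_closed\<close>)+
  then show ?thesis
    using all_if[of b] swap ab xy by blast
qed

lemma commutators_commute_if_two_generated:
  assumes MC: "\<And>m g a b. m \<in> M \<Longrightarrow> g \<in> carrier G \<Longrightarrow> a \<in> carrier G \<Longrightarrow> b \<in> carrier G \<Longrightarrow>
      commutator G (commutator G m g) (commutator G a b) = \<one>"
    and comm: "\<And>a b. a \<in> carrier G \<Longrightarrow> b \<in> carrier G \<Longrightarrow> commutator G a b \<in> M"
    and xy: "x \<in> carrier G" "y \<in> carrier G" and M: "M \<subseteq> carrier G"
    and gen: "generate G (insert x (insert y M)) = carrier G"
    and ab: "a \<in> carrier G" "b \<in> carrier G" and cd: "c \<in> carrier G" "d \<in> carrier G"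
  shows "commutator G (commutator G a b) (commutator G c d) = \<one>"
proof -
  let ?K = "{commutator G u v | u v. u \<in> carrier G \<and> v \<in> carrier G}"
  have sub: "subgroup (centralizer G {commutator G x y}) G" "subgroup (centralizer G ?K) G"
    using xy by (auto intro!: centralizer_subgroup)
  have MK: "commutator G m g \<in> centralizer G ?K" if "m \<in> M" "g \<in> carrier G" for m g
    using MC[OF that] that M by (auto simp: centralizer_def commutator_eq_one_iff subset_iff)
  \<comment> \<open>First pass: the centraliser of the single element
    \<open>commutator G x y\<close> contains that element, hence every commutator.\<close>
  have "commutator G u v \<in> centralizer G {commutator G x y}"
    if "u \<in> carrier G" "v \<in> carrier G" for u v
  proof (rule commutator_in_subgroup_if_two_generated[OF sub(1) _ comm xy M gen _ that])
    show "commutator G m g \<in> centralizer G {commutator G x y}" if "m \<in> M" "g \<in> carrier G" for m g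
      using MK[OF that] xy by (auto simp: centralizer_def)
  qed (use xy in \<open>auto simp: centralizer_def\<close>)
  \<comment> \<open>Commuting is symmetric, so the first pass provides the starting point of a
    second pass with the centraliser of all commutators.\<close>
  then have "commutator G x y \<in> centralizer G ?K"
    using xy by (auto simp: centralizer_def)
  then have "commutator G a b \<in> centralizer G ?K"
    using MK by (intro commutator_in_subgroup_if_two_generated[OF sub(2) _ comm xy M gen _ ab]) auto
  then show ?thesis
    using ab cd by (auto simp: centralizer_def commutator_eq_one_iff)
qed

end

section \<open>The quotient by the metabelian marginal subgroup\<close>

lemma word_value_metabelian_word:
  "word_value G g metabelian_word =
    commutator G (commutator G (g 0) (g 1)) (commutator G (g 2) (g 3))"
  by (simp add: metabelian_word_def word_commutator_def commutator_def)

lemma (in group) marginal_metabelian_eq_carrier: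
  fixes M
  defines "M \<equiv> marginal_subgroup {metabelian_word} G"
  assumes comm: "\<And>a b. a \<in> carrier G \<Longrightarrow> b \<in> carrier G \<Longrightarrow> commutator G a b \<in> M"
    and xy: "x \<in> carrier G" "y \<in> carrier G"
    and gen: "generate G (insert x (insert y M)) = carrier G"
  shows "M = carrier G"
proof -
  have M: "M \<subseteq> carrier G"
    by (auto simp: M_def marginal_subgroup_def)
  have MC: "commutator G (commutator G m g) (commutator G a b) = \<one>"
    if "m \<in> M" "g \<in> carrier G" "a \<in> carrier G" "b \<in> carrier G" for m g a b
  proof -
    \<comment> \<open>With variable 0 set to \<open>\<one>\<close> the word has value
      \<open>\<one>\<close>; multiplying that variable by \<open>m\<close> turns the value into the
      commutator of the claim.\<close>
    let ?f = "(\<lambda>i. \<one>)(1 := g, 2 := a, 3 := b) :: nat \<Rightarrow> 'a"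
    have "?f \<in> UNIV \<rightarrow> carrier G"
      using that by auto
    then have "word_value G (?f(0 := ?f 0 \<otimes> m)) metabelian_word = word_value G ?f metabelian_word"
      using \<open>m \<in> M\<close> unfolding M_def marginal_subgroup_def by blast
    then show ?thesis
      using that M by (auto simp: word_value_metabelian_word subset_iff)
  qed
  have "commutator G (commutator G a b) (commutator G c d) = \<one>"
    if "a \<in> carrier G" "b \<in> carrier G" "c \<in> carrier G" "d \<in> carrier G" for a b c d
    by (rule commutators_commute_if_two_generated[OF MC comm xy M gen that])
  \<comment> \<open>The word is identically trivial on the group, so no shift changes its value and
    every element is marginal.\<close>
  then have "word_value G g metabelian_word = \<one>" if "g \<in> UNIV \<rightarrow> carrier G" for g
    using that by (auto simp: word_value_metabelian_word Pi_iff)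
  then show ?thesis
    by (auto simp: M_def marginal_subgroup_def Pi_iff)
qed

text \<open>Some \<open>k\<close> generated by \<open>x\<close> and \<open>y\<close> has the same
  image as \<open>g\<close>; then \<open>g\<close> is \<open>g \<otimes> inv k\<close>, which lies
  in the kernel, times \<open>k\<close>.\<close>

lemma (in group_hom) generate_insert_kernel:
  assumes H: "generate H {h x, h y} = carrier H" and xy: "x \<in> carrier G" "y \<in> carrier G"
  shows "generate G (insert x (insert y (kernel G H h))) = carrier G"
proof
  let ?S = "insert x (insert y (kernel G H h))"
  have S: "?S \<subseteq> carrier G"
    using xy by (auto simp: kernel_def)
  then show "generate G ?S \<subseteq> carrier G"
    by (rule G.generate_incl)
  show "carrier G \<subseteq> generate G ?S"
  proof
    fix g
    assume g: "g \<in> carrier G"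
    have "generate H {h x, h y} = h ` generate G {x, y}"
      using generate_img[of "{x, y}"] xy by simp
    then obtain k where k: "k \<in> generate G {x, y}" "h g = h k"
      using H g hom_closed by blast
    have k': "k \<in> generate G ?S" "k \<in> carrier G"
      using k(1) G.mono_generate[of "{x, y}" ?S] S G.generate_incl by blast+
    have "g \<otimes> inv k \<in> generate G ?S"
      using g k k' by (intro generate.incl) (simp add: kernel_def)
    from generate.eng[OF this k'(1)] show "g \<in> generate G ?S"
      using g k' by (simp add: G.m_assoc)
  qed
qed

lemma not_variety_capable_metabelian_if_two_generated:
  assumes G: "comm_group G" and uv: "u \<in> carrier G" "v \<in> carrier G"
    and gen: "generate G {u, v} = carrier G" and nontrivial: "carrier G \<noteq> {\<one>\<^bsub>G\<^esub>}"
  shows "\<not> variety_capable TYPE('e) {metabelian_word} G"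
proof
  assume "variety_capable TYPE('e) {metabelian_word} G"
  then obtain E :: "'e monoid" where "group E"
    and iso: "G \<cong> E Mod marginal_subgroup {metabelian_word} E"
    unfolding variety_capable_def by blast
  interpret E: group E by fact
  interpret G: comm_group G by fact
  let ?M = "marginal_subgroup {metabelian_word} E"
  interpret M: normal ?M E
    by (rule E.marginal_subgroup_normal)
  obtain \<psi> where \<psi>: "\<psi> \<in> iso (E Mod ?M) G"
    using G.iso_sym[OF iso] by (auto simp: is_iso_def)
  \<comment> \<open>The canonical projection followed by the isomorphism presents \<open>G\<close>
    as an image of \<open>E\<close> with the marginal subgroup as kernel.\<close>
  let ?f = "\<lambda>e. \<psi> (?M #>\<^bsub>E\<^esub> e)"
  have hom: "?f \<in> hom E G"
    using hom_compose[OF M.r_coset_hom_Mod, of \<psi> G] \<psi> by (simp add: iso_def comp_def)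
  interpret f: group_hom E G ?f
    using hom by unfold_locales
  have surj: "?f ` carrier E = carrier G"
    using \<psi> by (auto simp: iso_def bij_betw_def FactGroup_def RCOSETS_def)
  have ker: "kernel E G ?f = ?M"
  proof -
    have inj: "inj_on \<psi> (carrier (E Mod ?M))"
      using \<psi> by (simp add: iso_def bij_betw_def)
    have "?f e = \<one>\<^bsub>G\<^esub> \<longleftrightarrow> e \<in> ?M" if e: "e \<in> carrier E" for e
    proof -
      have "?f e = \<one>\<^bsub>G\<^esub> \<longleftrightarrow> ?f e = ?f \<one>\<^bsub>E\<^esub>"
        by (simp only: f.hom_one)
      also have "\<dots> \<longleftrightarrow> ?M #>\<^bsub>E\<^esub> e = ?M #>\<^bsub>E\<^esub> \<one>\<^bsub>E\<^esub>"
        by (rule inj_on_eq_iff[OF inj]) (use e in \<open>auto simp: FactGroup_def RCOSETS_def\<close>)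
      also have "\<dots> \<longleftrightarrow> ?M #>\<^bsub>E\<^esub> e = ?M"
        by (simp only: E.coset_mult_one[OF M.subset])
      also have "\<dots> \<longleftrightarrow> e \<in> ?M"
        using e E.coset_join1 E.coset_join2 M.subgroup_axioms M.subset by metis
      finally show ?thesis .
    qed
    then show ?thesis
      using M.subset by (auto simp: kernel_def)
  qed
  obtain x y where xy: "x \<in> carrier E" "y \<in> carrier E" and "u = ?f x" "v = ?f y"
    using uv surj by blast
  with gen have "generate E (insert x (insert y ?M)) = carrier E"
    using f.generate_insert_kernel[of x y] ker by simp
  \<comment> \<open>Commutators of \<open>E\<close> die in the abelian group
    \<open>G\<close>.\<close>
  moreover have "commutator E a b \<in> ?M" if "a \<in> carrier E" "b \<in> carrier E" for a b
  proof -
    have "?f (commutator E a b) = commutator G (?f a) (?f b)"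
      using that by (simp add: commutator_def)
    also have "\<dots> = \<one>\<^bsub>G\<^esub>"
      using that by (simp add: G.commutator_eq_one_iff G.m_comm)
    finally have "commutator E a b \<in> kernel E G ?f"
      using that by (simp add: kernel_def)
    then show ?thesis
      by (simp only: ker)
  qed
  ultimately have M_eq: "?M = carrier E"
    using xy by (intro E.marginal_metabelian_eq_carrier[of x y])
  \<comment> \<open>The kernel is now all of \<open>E\<close>, so the surjection onto
    \<open>G\<close> is trivial, against \<open>nontrivial\<close>.\<close>
  have "?f e = \<one>\<^bsub>G\<^esub>" if "e \<in> carrier E" for e
  proof -
    have "e \<in> ?M"
      by (simp add: M_eq that)
    then have "e \<in> kernel E G ?f"
      by (simp only: ker)
    then show ?thesis
      by (simp add: kernel_def)
  qed
  then have "carrier G \<subseteq> {\<one>\<^bsub>G\<^esub>}"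
    unfolding surj[symmetric] by blast
  with nontrivial show False
    using G.one_closed by blast
qed

section \<open>Generators of the direct square and the conclusion\<close>

lemma generate_integer_mod_group_square:
  assumes "n \<ge> 2"
  shows "generate (integer_mod_group n \<times>\<times> integer_mod_group n) {(1, 0), (0, 1)} =
    carrier (integer_mod_group n \<times>\<times> integer_mod_group n)"
  (is "generate ?G ?S = _")
proof
  interpret group ?G
    by (intro DirProd_group group_integer_mod_group)
  have S: "?S \<subseteq> carrier ?G"
    using assms by auto
  show "generate ?G ?S \<subseteq> carrier ?G"
    using S by (rule generate_incl)
  \<comment> \<open>In the induction step \<open>Suc k < n\<close>, so adding a generator never
    wraps around modulo \<open>n\<close>.\<close>
  have axes: "(int k, 0) \<in> generate ?G ?S \<and> (0, int k) \<in> generate ?G ?S" if "k < n" for k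
    using that
  proof (induction k)
    case 0
    then show ?case
      using generate.one[of ?G ?S] by simp
  next
    case (Suc k)
    then have IH: "(int k, 0) \<in> generate ?G ?S" "(0, int k) \<in> generate ?G ?S"
      by simp_all
    from generate.eng[OF generate.incl IH(1), of "(1, 0)"] generate.eng[OF generate.incl IH(2), of "(0, 1)"]
      Suc.prems show ?case
      by simp
  qed
  show "carrier ?G \<subseteq> generate ?G ?S"
  proof clarify
    fix a b
    assume ab: "(a, b) \<in> carrier ?G"
    then have "(a, 0) \<in> generate ?G ?S" "(0, b) \<in> generate ?G ?S"
      using assms axes[of "nat a"] axes[of "nat b"] by (simp_all add: carrier_integer_mod_group nat_less_iff)
    from generate.eng[OF this] show "(a, b) \<in> generate ?G ?S"
      using ab assms by (simp add: carrier_integer_mod_group)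
  qed
qed

text \<open>At \<open>n = 1\<close> the group is trivial, hence the quotient of a trivial group by
  its marginal subgroup, so the denial starts at \<open>n = 2\<close>. The free type
  \<open>'e\<close> covers groups of every element type.\<close>

theorem theorem4p2:
  fixes n :: nat
  assumes "n \<ge> 1"
  shows "capable TYPE(nat) (integer_mod_group n \<times>\<times> integer_mod_group n) \<and>
    (n \<noteq> 1 \<longrightarrow>
      \<not> variety_capable TYPE('e) {metabelian_word}
          (integer_mod_group n \<times>\<times> integer_mod_group n))"
proof (intro conjI impI)
  show "capable TYPE(nat) (integer_mod_group n \<times>\<times> integer_mod_group n)"
    using assms by (rule capable_nat_integer_mod_group_square)
  assume "n \<noteq> 1"
  with assms have n: "n \<ge> 2"
    by simp
  let ?G = "integer_mod_group n \<times>\<times> integer_mod_group n"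
  have mem: "(1, 0) \<in> carrier ?G" "(0, 1) \<in> carrier ?G"
    using n by (auto simp: DirProd_def)
  moreover have "comm_group ?G"
    by (rule group.group_comm_groupI) (auto simp: DirProd_group add.commute)
  moreover have "carrier ?G \<noteq> {\<one>\<^bsub>?G\<^esub>}"
  proof -
    have "(1, 0) \<noteq> \<one>\<^bsub>?G\<^esub>"
      by simp
    with mem(1) show ?thesis
      by blast
  qed
  ultimately show "\<not> variety_capable TYPE('e) {metabelian_word} ?G"
    using generate_integer_mod_group_square[OF n]
    by (intro not_variety_capable_metabelian_if_two_generated)
qed

end
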